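(* Let $F\colon\mathbb{R}^m\to\mathbb{R}$ be a permutation invariant averaging operator for which there exists $0<\kappa<1$ such that $F(x_1+c',x_2,\dots,x_m)\le F(x_1,\dots,x_m)+c'\kappa$ for all $(x_1,\dots,x_m)\in\mathbb{R}^m$ and all $c'>0$. Let $f\colon[0,1]\to\mathbb{R}$ be a continuous function, let $I$ be a subinterval of $[0,1]$ with measure $|I|$, and let $c>0$. If $u$ is the solution of the Dirichlet problem (DP) with boundary data $f$, then $$0\le \inf\{w(\emptyset)-u(\emptyset)\colon w\in U_F(f,I,c)\}\le 2c\,(m|I|)^{\gamma}$$ for any $\gamma\le-\log_m(\kappa)$.
   Context: Fix an integer $m\ge 3$. The directed tree $\mathbb{T}_m$ with regular $m$-branching has as vertices the empty sequence $\emptyset$ and all finite sequences $(a_1,\dots,a_k)$, $k\ge1$, with $a_i\in\{0,\dots,m-1\}$. The successors of a vertex $x$ are the $m$ vertices $(x,0),\dots,(x,m-1)$ obtained by appending one coordinate. The boundary $\partial\mathbb{T}_m$ is the set of branches, i.e. infinite sequences $(a_1,a_2,\dots)$ in $\{0,\dots,m-1\}$; a branch is also written $\pi=(x_1,x_2,\dots)$ with $x_k=(a_1,\dots,a_k)$. Let $\psi\colon\partial\mathbb{T}_m\to[0,1]$, $\psi(\pi)=\sum_{k\ge1}a_km^{-k}$. For a function $g$ on $[0,1]$ write $g(\pi)=g(\psi(\pi))$; for $I\subset[0,1]$, $\chi_I(\pi)=1$ if $\psi(\pi)\in I$ and $0$ otherwise. An averaging operator is a continuous $F\colon\mathbb{R}^m\to\mathbb{R}$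 such that: (i) $F(0,\dots,0)=0$ and $F(1,\dots,1)=1$; (ii) $F(tx_1,\dots,tx_m)=tF(x_1,\dots,x_m)$ for all $t\in\mathbb{R}$; (iii) $F(t+x_1,\dots,t+x_m)=t+F(x_1,\dots,x_m)$ for all $t\in\mathbb{R}$; (iv) $F(x_1,\dots,x_m)<\max\{x_1,\dots,x_m\}$ if not all $x_j$ are equal; (v) $F$ is nondecreasing in each variable. It is permutation invariant if $F(x_1,\dots,x_m)=F(x_{\tau(1)},\dots,x_{\tau(m)})$ for every permutation $\tau$ of $\{1,\dots,m\}$. A function $u\colon\mathbb{T}_m\to\mathbb{R}$ is $F$-subharmonic if $u(x)\le F(u(x,0),\dots,u(x,m-1))$ for all $x\in\mathbb{T}_m$, $F$-superharmonic if the opposite inequality holds for all $x$, and $F$-harmonic if both hold. A solution of (DP) with boundary data $f$ is an $F$-harmonic $u$ with $\lim_{k\to\infty}u(x_k)=f(\pi)$ for every $\pi=(x_1,x_2,\dots)\in\partial\mathbb{T}_m$ (for continuous $f$ it exists and is unique). $U_F(f,I,c)$ is the set of all $F$-superharmonic functions $w$ such that $\liminf_{k\to\infty}w(x_k)\ge f(\pi)+c\chi_I(\pi)$ for all $\pi=(x_1,x_2,\dots)\in\partial\mathbb{T}_m$.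
   Formalization: The upper bound is stated for γ ≤ -log_m(κ) under the extra assumption that γ ≥ 0 or m|I| ≤ 1; without it the claim fails, e.g. m=3, F the arithmetic mean, f=0, I=[0,1], γ=-1, where the infimum is c > 2c/3. *)

theory Defs
  imports "HOL-Analysis.Analysis"
begin

text \<open>
  \<open>\<real>\<^sup>m\<close> is \<^term>\<open>topspace (Euclidean_space m)\<close>: functions \<open>nat \<Rightarrow> real\<close> vanishing from index \<open>m\<close> on.
  Coordinates are therefore numbered \<open>0, \<dots>, m - 1\<close>, in line with the digits labelling the successors
  of a vertex.
\<close>

definition vec_of :: "nat \<Rightarrow> (nat \<Rightarrow> real) \<Rightarrow> nat \<Rightarrow> real" where
  "vec_of m g = (\<lambda>i. if i < m then g i else 0)"

definition averaging_operator :: "nat \<Rightarrow> ((nat \<Rightarrow> real) \<Rightarrow> real) \<Rightarrow> bool" where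
  "averaging_operator m F \<longleftrightarrow>
     continuous_map (Euclidean_space m) euclideanreal F \<and>
     F (vec_of m (\<lambda>i. 0)) = 0 \<and> F (vec_of m (\<lambda>i. 1)) = 1 \<and>
     (\<forall>x \<in> topspace (Euclidean_space m). \<forall>t. F (vec_of m (\<lambda>i. t * x i)) = t * F x) \<and>
     (\<forall>x \<in> topspace (Euclidean_space m). \<forall>t. F (vec_of m (\<lambda>i. t + x i)) = t + F x) \<and>
     (\<forall>x \<in> topspace (Euclidean_space m).
        (\<exists>i<m. \<exists>j<m. x i \<noteq> x j) \<longrightarrow> F x < Max (x ` {..<m})) \<and>
     (\<forall>x \<in> topspace (Euclidean_space m). \<forall>i<m. \<forall>s. x i \<le> s \<longrightarrow> F x \<le> F (x(i := s)))"

definition permutation_invariant :: "nat \<Rightarrow> ((nat \<Rightarrow> real) \<Rightarrow> real) \<Rightarrow> bool" where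
  "permutation_invariant m F \<longleftrightarrow>
     (\<forall>x \<in> topspace (Euclidean_space m). \<forall>\<tau>. \<tau> permutes {..<m} \<longrightarrow> F (\<lambda>i. x (\<tau> i)) = F x)"

definition tree :: "nat \<Rightarrow> nat list set" where
  "tree m = lists {..<m}"

text \<open>
  Functions on the tree are total functions on \<open>nat list\<close>; every condition below only concerns their
  values on \<^term>\<open>tree m\<close>.
\<close>

definition successor_values :: "nat \<Rightarrow> (nat list \<Rightarrow> real) \<Rightarrow> nat list \<Rightarrow> nat \<Rightarrow> real" where
  "successor_values m u x = vec_of m (\<lambda>i. u (x @ [i]))"

definition subharmonic :: "nat \<Rightarrow> ((nat \<Rightarrow> real) \<Rightarrow> real) \<Rightarrow> (nat list \<Rightarrow> real) \<Rightarrow> bool" where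
  "subharmonic m F u \<longleftrightarrow> (\<forall>x \<in> tree m. u x \<le> F (successor_values m u x))"

definition superharmonic :: "nat \<Rightarrow> ((nat \<Rightarrow> real) \<Rightarrow> real) \<Rightarrow> (nat list \<Rightarrow> real) \<Rightarrow> bool" where
  "superharmonic m F u \<longleftrightarrow> (\<forall>x \<in> tree m. u x \<ge> F (successor_values m u x))"

definition harmonic :: "nat \<Rightarrow> ((nat \<Rightarrow> real) \<Rightarrow> real) \<Rightarrow> (nat list \<Rightarrow> real) \<Rightarrow> bool" where
  "harmonic m F u \<longleftrightarrow> subharmonic m F u \<and> superharmonic m F u"

text \<open>A branch is its digit sequence; digit \<open>k\<close> here is the usual \<open>a\<^sub>k\<^sub>+\<^sub>1\<close>.\<close>

definition branches :: "nat \<Rightarrow> (nat \<Rightarrow> nat) set" where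
  "branches m = {a. \<forall>k. a k < m}"

definition branch_vertex :: "(nat \<Rightarrow> nat) \<Rightarrow> nat \<Rightarrow> nat list" where
  "branch_vertex a k = map a [0..<k]"

definition branch_point :: "nat \<Rightarrow> (nat \<Rightarrow> nat) \<Rightarrow> real" where
  "branch_point m a = (\<Sum>k. real (a k) / real m ^ Suc k)"

definition solves_DP ::
  "nat \<Rightarrow> ((nat \<Rightarrow> real) \<Rightarrow> real) \<Rightarrow> (real \<Rightarrow> real) \<Rightarrow> (nat list \<Rightarrow> real) \<Rightarrow> bool" where
  "solves_DP m F f u \<longleftrightarrow> harmonic m F u \<and>
     (\<forall>a \<in> branches m. (\<lambda>k. u (branch_vertex a k)) \<longlonglongrightarrow> f (branch_point m a))"

definition upper_class ::
  "nat \<Rightarrow> ((nat \<Rightarrow> real) \<Rightarrow> real) \<Rightarrow> (real \<Rightarrow> real) \<Rightarrow> real set \<Rightarrow> real \<Rightarrow> (nat list \<Rightarrow> real) set" where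
  "upper_class m F f I c =
     {w. superharmonic m F w \<and>
         (\<forall>a \<in> branches m. liminf (\<lambda>k. ereal (w (branch_vertex a k)))
            \<ge> ereal (f (branch_point m a) + c * indicator I (branch_point m a)))}"

end

theory Submission
  imports Defs
begin

text \<open>
  The lower bound is a comparison principle: if \<open>w - u\<close> takes the value \<open>d\<close> at a vertex, then some
  successor has \<open>w - u \<le> d\<close>, since otherwise monotonicity and translation invariance of \<open>F\<close> would
  push \<open>w\<close> above \<open>u + d\<close>; following these successors yields a branch that contradicts \<open>d < 0\<close>.

  For the upper bound, raising the data by \<open>c\<close> below a single vertex of level \<open>N\<close> costs at most
  \<open>c * \<kappa> ^ N\<close> at the root, because each step towards the root gains a factor \<open>\<kappa>\<close>. When
  \<open>m powr - (N + 1) \<le> \<bar>I\<bar> < m powr - N\<close>, the branches ending in \<open>I\<close> pass through at most two vertices of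
  level \<open>N\<close>, and \<open>\<kappa> ^ N \<le> (m * \<bar>I\<bar>) powr - log m \<kappa>\<close>.
\<close>

section \<open>Consequences of the averaging axioms for vectors of successor values\<close>

lemma vec_of_in_space [simp]: "vec_of m g \<in> topspace (Euclidean_space m)"
  by (simp add: vec_of_def topspace_Euclidean_space)

text \<open>The axiom varies a single coordinate, so \<open>g\<close> is exchanged for
  \<open>h\<close> one coordinate at a time: \<open>z n\<close> already agrees with \<open>h\<close>
  below \<open>n\<close> and still with \<open>g\<close> from \<open>n\<close> on.\<close>

lemma averaging_operator_mono:
  assumes "averaging_operator m F" and "\<And>i. i < m \<Longrightarrow> g i \<le> h i"
  shows "F (vec_of m g) \<le> F (vec_of m h)"
proof -
  define z where "z n = vec_of m (\<lambda>i. if i < n then h i else g i)" for n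
  have "F (vec_of m g) \<le> F (z n)" if "n \<le> m" for n
    using that
  proof (induction n)
    case 0
    then show ?case by (simp add: z_def)
  next
    case (Suc n)
    have "z (Suc n) = (z n)(n := h n)"
      using Suc.prems by (auto simp: z_def vec_of_def fun_eq_iff)
    moreover have "z n n \<le> h n"
      using Suc.prems assms(2)[of n] by (simp add: z_def vec_of_def)
    moreover have "z n \<in> topspace (Euclidean_space m)"
      by (simp add: z_def)
    ultimately have "F (z n) \<le> F (z (Suc n))"
      using assms(1) Suc.prems unfolding averaging_operator_def by (metis Suc_le_eq)
    then show ?case
      using Suc by linarith
  qed
  moreover have "z m = vec_of m h"
    by (auto simp: z_def vec_of_def)
  ultimately show ?thesis by (metis order_refl)
qed

lemma averaging_operator_add_const:
  assumes "averaging_operator m F"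
  shows "F (vec_of m (\<lambda>i. g i + t)) = F (vec_of m g) + t"
proof -
  have "vec_of m (\<lambda>i. t + vec_of m g i) = vec_of m (\<lambda>i. g i + t)"
    by (auto simp: vec_of_def)
  moreover have "\<forall>x \<in> topspace (Euclidean_space m). \<forall>t. F (vec_of m (\<lambda>i. t + x i)) = t + F x"
    using assms unfolding averaging_operator_def by (elim conjE)
  then have "F (vec_of m (\<lambda>i. t + vec_of m g i)) = t + F (vec_of m g)"
    using vec_of_in_space by (elim ballE allE) auto
  ultimately show ?thesis by simp
qed

text \<open>The transposition of \<open>0\<close> and \<open>j\<close> moves the increment to
  coordinate \<open>0\<close>, where \<open>incr\<close> applies. The case \<open>t = 0\<close> is
  included because a barrier may contribute nothing at a vertex.\<close>

lemma permutation_invariant_increment: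
  assumes "permutation_invariant m F"
    and incr: "\<And>x t. x \<in> topspace (Euclidean_space m) \<Longrightarrow> t > 0 \<Longrightarrow>
           F (x(0 := x 0 + t)) \<le> F x + t * \<kappa>"
    and x: "x \<in> topspace (Euclidean_space m)" and j: "j < m" and "t \<ge> 0"
  shows "F (x(j := x j + t)) \<le> F x + t * \<kappa>"
proof (cases "t = 0")
  case False
  define \<tau> where "\<tau> = Transposition.transpose 0 j"
  have \<tau>: "\<tau> permutes {..<m}"
    using j by (simp add: \<tau>_def permutes_swap_id)
  have perm: "F (\<lambda>i. y (\<tau> i)) = F y" if "y \<in> topspace (Euclidean_space m)" for y
    using assms(1) \<tau> that unfolding permutation_invariant_def by blast
  have in_space: "x(j := x j + t) \<in> topspace (Euclidean_space m)"
      "(\<lambda>i. x (\<tau> i)) \<in> topspace (Euclidean_space m)"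
    using x j by (auto simp: topspace_Euclidean_space \<tau>_def Transposition.transpose_def)
  have "F (x(j := x j + t)) = F (\<lambda>i. (x(j := x j + t)) (\<tau> i))"
    using perm[OF in_space(1)] by simp
  also have "(\<lambda>i. (x(j := x j + t)) (\<tau> i)) = (\<lambda>i. x (\<tau> i))(0 := x (\<tau> 0) + t)"
    by (auto simp: \<tau>_def Transposition.transpose_def fun_eq_iff)
  also have "F \<dots> \<le> F (\<lambda>i. x (\<tau> i)) + t * \<kappa>"
    using incr[OF in_space(2), of t] False \<open>t \<ge> 0\<close> by simp
  finally show ?thesis
    unfolding perm[OF x] .
qed simp

section \<open>Comparison of subharmonic and superharmonic functions\<close>

lemma comparison_principle:
  assumes F: "averaging_operator m F" and m: "m > 0"
    and sub: "subharmonic m F u" and super: "superharmonic m F w"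
    and bdry: "\<And>a. a \<in> branches m \<Longrightarrow> \<exists>l. (\<lambda>k. u (branch_vertex a k)) \<longlonglongrightarrow> l \<and>
           ereal l \<le> liminf (\<lambda>k. ereal (w (branch_vertex a k)))"
  shows "u [] \<le> w []"
proof (rule ccontr)
  assume neg: "\<not> u [] \<le> w []"
  define d where "d = w [] - u []"
  have step: "\<exists>i<m. w (x @ [i]) - u (x @ [i]) \<le> d"
    if "x \<in> tree m" "w x - u x \<le> d" for x
  proof (rule ccontr)
    assume "\<not> ?thesis"
    then have gt: "w (x @ [i]) - u (x @ [i]) > d" if "i < m" for i
      using that by force
    \<comment> \<open>\<open>F\<close> is only nondecreasing, so strict inequalities in all
      coordinates need not survive it. The minimum \<open>D\<close> is a uniform gap, which
      translation invariance carries through \<open>F\<close> unchanged.\<close>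
    define D where "D = Min ((\<lambda>i. w (x @ [i]) - u (x @ [i])) ` {..<m})"
    have "D > d"
      unfolding D_def using gt m by (subst Min_gr_iff) auto
    have D: "u (x @ [i]) + D \<le> w (x @ [i])" if "i < m" for i
    proof -
      have "D \<le> w (x @ [i]) - u (x @ [i])"
        using that by (auto simp: D_def)
      then show ?thesis by simp
    qed
    have "F (successor_values m u x) + D \<le> F (successor_values m w x)"
      unfolding successor_values_def
      by (subst averaging_operator_add_const[OF F, symmetric])
        (auto intro: averaging_operator_mono[OF F] D)
    moreover have "u x \<le> F (successor_values m u x)" "F (successor_values m w x) \<le> w x"
      using sub super \<open>x \<in> tree m\<close> by (auto simp: subharmonic_def superharmonic_def)
    ultimately show False
      using \<open>D > d\<close> that(2) by linarith
  qed
  define child where "child x = (SOME i. i < m \<and> w (x @ [i]) - u (x @ [i]) \<le> d)" for x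
  define path where "path = rec_nat [] (\<lambda>_ x. x @ [child x])"
  define a where "a k = child (path k)" for k
  have path_Suc: "path (Suc k) = path k @ [a k]" for k
    by (simp add: path_def a_def)
  have path: "path k \<in> tree m \<and> w (path k) - u (path k) \<le> d \<and> a k < m" for k
  proof (induction k)
    case 0
    then show ?case
      using someI_ex[OF step[of "[]"]]
      by (simp add: path_def tree_def d_def a_def child_def)
  next
    case (Suc k)
    have "w (path (Suc k)) - u (path (Suc k)) \<le> d"
      using someI_ex[OF step[of "path k"]] Suc by (simp add: path_Suc a_def child_def)
    moreover have "path (Suc k) \<in> tree m"
      using Suc by (simp add: path_Suc tree_def)
    ultimately show ?case
      using someI_ex[OF step[of "path (Suc k)"]] by (simp add: a_def child_def)
  qed
  have vertex: "branch_vertex a k = path k" for k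
    by (induction k) (simp_all add: branch_vertex_def path_Suc, simp add: path_def)
  have a: "a \<in> branches m"
    using path by (simp add: branches_def)
  obtain l where l: "(\<lambda>k. u (path k)) \<longlonglongrightarrow> l"
      and le: "ereal l \<le> liminf (\<lambda>k. ereal (w (path k)))"
    using bdry[OF a] unfolding vertex by blast
  \<comment> \<open>Along the path \<open>w\<close> stays below \<open>u + d\<close>, so its liminf
    is at most \<open>l + d\<close>, which is less than \<open>l\<close> because \<open>d\<close> is
    negative.\<close>
  have "(\<lambda>k. ereal (u (path k) + d)) \<longlonglongrightarrow> ereal (l + d)"
    using l by (intro tendsto_intros)
  then have "liminf (\<lambda>k. ereal (u (path k) + d)) = ereal (l + d)"
    by (simp add: lim_imp_Liminf)
  moreover have "liminf (\<lambda>k. ereal (w (path k))) \<le> liminf (\<lambda>k. ereal (u (path k) + d))"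
  proof (rule Liminf_mono, intro always_eventually allI)
    show "ereal (w (path k)) \<le> ereal (u (path k) + d)" for k
      using path[of k] by simp
  qed
  ultimately have "ereal l \<le> ereal (l + d)"
    using le by (metis order_trans)
  then show False
    using neg by (simp add: d_def)
qed

section \<open>Barriers that raise the data below one vertex\<close>

text \<open>The indicator of the subtree rooted at \<open>y\<close>, continued to the ancestors of
  \<open>y\<close> with the decay per step that the increment bound on \<open>F\<close>
  allows.\<close>

definition barrier :: "real \<Rightarrow> nat list \<Rightarrow> nat list \<Rightarrow> real" where
  "barrier \<kappa> y x =
     (if length y \<le> length x then of_bool (take (length y) x = y)
      else of_bool (take (length x) y = x) * \<kappa> ^ (length y - length x))"

lemma barrier_nonneg: "\<kappa> \<ge> 0 \<Longrightarrow> barrier \<kappa> y x \<ge> 0"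
  by (simp add: barrier_def)

lemma barrier_Nil: "barrier \<kappa> y [] = \<kappa> ^ length y"
  by (simp add: barrier_def)

text \<open>Strictly above the level of \<open>y\<close> only the successor pointing towards
  \<open>y\<close> can carry a nonzero value, so adding a barrier alters at most one argument of
  \<open>F\<close>.\<close>

lemma barrier_successor_above:
  assumes "length x < length y"
  shows "barrier \<kappa> y (x @ [i]) * \<kappa> = (if i = y ! length x then barrier \<kappa> y x else 0)"
proof -
  let ?n = "length x"
  have take: "take (Suc ?n) y = take ?n y @ [y ! ?n]"
    using assms by (rule take_Suc_conv_app_nth)
  show ?thesis
  \<comment> \<open>When the successors lie on the level of \<open>y\<close>, they fall under the
    first branch of \<open>barrier\<close> while \<open>x\<close> falls under the second; otherwise
    both use the second.\<close>
  proof (cases "length y = Suc ?n")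
    case True
    then have "y = take ?n y @ [y ! ?n]"
      using take by simp
    then have "x @ [i] = y \<longleftrightarrow> take ?n y = x \<and> i = y ! ?n"
      by (metis append1_eq_conv)
    with True show ?thesis
      by (auto simp: barrier_def)
  next
    case False
    then have "length y - ?n = Suc (length y - Suc ?n)" "\<not> length y \<le> Suc ?n"
      using assms by auto
    with take show ?thesis
      by (auto simp: barrier_def)
  qed
qed

text \<open>From the level of \<open>y\<close> on, the barrier is constant on siblings and acts as a
  translation. Above that level it changes one coordinate, and the factor \<kappa> of the increment
  bound cancels the growth of the barrier towards \<open>y\<close>.\<close>

lemma superharmonic_add_barrier:
  assumes F: "averaging_operator m F"
    and incr: "\<And>x t j. x \<in> topspace (Euclidean_space m) \<Longrightarrow> j < m \<Longrightarrow> t \<ge> 0 \<Longrightarrow>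
           F (x(j := x j + t)) \<le> F x + t * \<kappa>"
    and "\<kappa> > 0" and "c \<ge> 0" and w: "superharmonic m F w"
  shows "superharmonic m F (\<lambda>x. w x + c * barrier \<kappa> y x)"
  unfolding superharmonic_def
proof
  fix x assume x: "x \<in> tree m"
  let ?v = "barrier \<kappa> y" and ?w = "\<lambda>x. w x + c * barrier \<kappa> y x"
  have "F (successor_values m ?w x) \<le> F (successor_values m w x) + c * ?v x"
  proof (cases "length y \<le> length x")
    case True
    then have "?v (x @ [i]) = ?v x" for i
      by (simp add: barrier_def)
    then show ?thesis
      by (simp add: successor_values_def averaging_operator_add_const[OF F])
  next
    case False
    define j where "j = y ! length x"
    have above: "?v (x @ [i]) * \<kappa> = (if i = j then ?v x else 0)" for i
      using False by (simp add: barrier_successor_above j_def)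
    then have zero: "?v (x @ [i]) = 0" if "i \<noteq> j" for i
      using that \<open>\<kappa> > 0\<close> by (metis mult_eq_0_iff less_irrefl)
    have nonneg: "c * ?v z \<ge> 0" for z
      using \<open>\<kappa> > 0\<close> \<open>c \<ge> 0\<close> by (simp add: barrier_nonneg)
    show ?thesis
    \<comment> \<open>The list \<open>y\<close> need not be a vertex of the tree. If its next entry
      is not a digit, the barrier vanishes at all successors of \<open>x\<close>.\<close>
    proof (cases "j < m")
      case True
      let ?s = "successor_values m w x"
      have "successor_values m ?w x = ?s(j := ?s j + c * ?v (x @ [j]))"
        using True zero by (auto simp: successor_values_def vec_of_def fun_eq_iff)
      moreover have "F (?s(j := ?s j + c * ?v (x @ [j]))) \<le> F ?s + c * ?v (x @ [j]) * \<kappa>"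
        by (intro incr True nonneg) (simp add: successor_values_def)
      ultimately show ?thesis
        using above[of j] by (simp add: mult.assoc)
    next
      case False
      then have "successor_values m ?w x = successor_values m w x"
        using zero by (auto simp: successor_values_def vec_of_def fun_eq_iff)
      then show ?thesis
        using nonneg[of x] by simp
    qed
  qed
  moreover have "F (successor_values m w x) \<le> w x"
    using w x by (simp add: superharmonic_def)
  ultimately show "F (successor_values m ?w x) \<le> ?w x"
    by linarith
qed

section \<open>Base-m digits and the vertices met by a short interval\<close>

text \<open>The integer with the first \<open>n\<close> digits of the branch in base
  \<open>m\<close>; it numbers the vertices of level \<open>n\<close> from left to right.\<close>

primrec prefix_value :: "nat \<Rightarrow> (nat \<Rightarrow> nat) \<Rightarrow> nat \<Rightarrow> nat" where
  "prefix_value m a 0 = 0"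
| "prefix_value m a (Suc n) = m * prefix_value m a n + a n"

text \<open>The remainder modulo \<open>m\<close> recovers the last digit, and induction the earlier
  ones.\<close>

lemma prefix_value_inj:
  assumes "a \<in> branches m" "b \<in> branches m" "prefix_value m a n = prefix_value m b n"
  shows "branch_vertex a n = branch_vertex b n"
  using assms(3)
proof (induction n)
  case (Suc n)
  have lt: "a n < m" "b n < m"
    using assms by (auto simp: branches_def)
  have "(m * prefix_value m a n + a n) mod m = (m * prefix_value m b n + b n) mod m"
    using Suc.prems by simp
  then have "a n = b n"
    using lt by simp
  with Suc lt show ?case
    by (simp add: branch_vertex_def)
qed (simp add: branch_vertex_def)

text \<open>Scaling by \<open>m ^ n\<close> turns the first \<open>n\<close> terms of the series
  into the prefix integer and leaves a tail between 0 and 1. The upper bound is attained by branches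
  whose digits from \<open>n\<close> on are all \<open>m - 1\<close>.\<close>

lemma branch_point_prefix_bounds:
  assumes m: "m \<ge> 2" and a: "a \<in> branches m"
  shows "real (prefix_value m a n) \<le> real m ^ n * branch_point m a"
    and "real m ^ n * branch_point m a \<le> real (prefix_value m a n) + 1"
proof -
  let ?t = "\<lambda>k. real (a k) / real m ^ Suc k"
  \<comment> \<open>\<open>?g n\<close> is the largest possible tail, with every digit equal to
    \<open>m - 1\<close>.\<close>
  let ?g = "\<lambda>n k. (real m - 1) / real m ^ Suc n * (1 / real m) ^ k"
  have g: "?g n sums (1 / real m ^ n)" for n
  proof -
    have "(\<lambda>k. (1 / real m) ^ k) sums (1 / (1 - 1 / real m))"
      using m by (intro geometric_sums) simp
    then have "?g n sums ((real m - 1) / real m ^ Suc n * (1 / (1 - 1 / real m)))"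
      by (rule sums_mult)
    moreover have "(real m - 1) / real m ^ Suc n * (1 / (1 - 1 / real m)) = 1 / real m ^ n"
      using m by (simp add: field_simps)
    ultimately show ?thesis by simp
  qed
  have le: "?t (k + n) \<le> ?g n k" for k n
  proof -
    have "a (k + n) < m"
      using a by (simp add: branches_def)
    then have "real (a (k + n)) \<le> real m - 1"
      by linarith
    then have "?t (k + n) \<le> (real m - 1) / real m ^ Suc (k + n)"
      by (intro divide_right_mono) auto
    also have "\<dots> = ?g n k"
      using m by (simp add: power_add field_simps)
    finally show ?thesis .
  qed
  have summable: "summable ?t"
  proof (rule summable_comparison_test')
    show "summable (?g 0)"
      using g by (rule sums_summable)
    show "norm (?t k) \<le> ?g 0 k" if "k \<ge> 0" for k
      using le[of k 0] by simp
  qed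
  then have tail: "summable (\<lambda>k. ?t (k + n))"
    by (rule summable_ignore_initial_segment)
  have prefix: "real m ^ n * (\<Sum>k<n. ?t k) = real (prefix_value m a n)"
  proof (induction n)
    case (Suc n)
    have "real m ^ Suc n * (\<Sum>k<Suc n. ?t k) = real m * (real m ^ n * (\<Sum>k<n. ?t k)) + real (a n)"
      using m by (simp add: distrib_left)
    then show ?case
      using Suc by simp
  qed simp
  have "branch_point m a = (\<Sum>k. ?t (k + n)) + (\<Sum>k<n. ?t k)"
    unfolding branch_point_def by (rule suminf_split_initial_segment[OF summable])
  then have split: "real m ^ n * branch_point m a
      = real (prefix_value m a n) + real m ^ n * (\<Sum>k. ?t (k + n))"
    using prefix by (simp add: distrib_left)
  have "(\<Sum>k. ?t (k + n)) \<ge> 0"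
    by (intro suminf_nonneg tail) simp
  then show "real (prefix_value m a n) \<le> real m ^ n * branch_point m a"
    by (simp add: split)
  have "(\<Sum>k. ?t (k + n)) \<le> 1 / real m ^ n"
    using suminf_le[OF le tail sums_summable[OF g]] sums_unique[OF g, of n] by simp
  then have "real m ^ n * (\<Sum>k. ?t (k + n)) \<le> real m ^ n * (1 / real m ^ n)"
    by (intro mult_left_mono) auto
  then show "real m ^ n * branch_point m a \<le> real (prefix_value m a n) + 1"
    using m by (simp add: split)
qed

text \<open>\<open>measure\<close> is 0 on sets of infinite measure; boundedness makes
  \<open>I\<close> of finite measure, so that monotonicity applies to the segment inside it.\<close>

lemma is_interval_diff_le_measure:
  fixes I :: "real set"
  assumes "is_interval I" "bounded I" "s \<in> I" "t \<in> I" "s \<le> t"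
  shows "t - s \<le> measure lborel I"
proof -
  obtain a b where "I \<subseteq> cbox a b"
    using assms(2) bounded_subset_cbox_symmetric by blast
  then have "I \<in> fmeasurable lborel"
    using real_interval_borel_measurable[OF assms(1)]
    by (intro fmeasurableI2[OF fmeasurable_cbox]) auto
  moreover have "{s..t} \<subseteq> I"
    using mem_is_interval_1_I[OF assms(1,3,4)] by auto
  ultimately have "measure lborel {s..t} \<le> measure lborel I"
    by (intro measure_mono_fmeasurable) auto
  then show ?thesis
    using assms(5) by simp
qed

text \<open>Prefix integers differing by 2 or more would place two points of \<open>I\<close> at
  distance at least \<open>1 / m ^ n\<close>. Hence only two consecutive integers occur, each
  belonging to one vertex.\<close>

lemma short_interval_two_vertices:
  assumes m: "m \<ge> 2" and I: "is_interval I" "bounded I"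
    and short: "measure lborel I < 1 / real m ^ n"
  obtains y z where "length y = n" "length z = n"
    "\<And>a. a \<in> branches m \<Longrightarrow> branch_point m a \<in> I \<Longrightarrow> branch_vertex a n \<in> {y, z}"
proof -
  define A where "A = {a \<in> branches m. branch_point m a \<in> I}"
  have close: "prefix_value m b n \<le> Suc (prefix_value m a n)" if "a \<in> A" "b \<in> A" for a b
  proof (rule ccontr)
    assume "\<not> ?thesis"
    then have "real (prefix_value m a n) + 2 \<le> real (prefix_value m b n)"
      by linarith
    moreover have "real m ^ n * branch_point m a \<le> real (prefix_value m a n) + 1"
      "real (prefix_value m b n) \<le> real m ^ n * branch_point m b"
      using branch_point_prefix_bounds[OF m] that by (auto simp: A_def)
    ultimately have "1 \<le> real m ^ n * (branch_point m b - branch_point m a)"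
      by (simp add: right_diff_distrib)
    then have diff: "1 / real m ^ n \<le> branch_point m b - branch_point m a"
      using m by (simp add: field_simps)
    have "0 \<le> branch_point m b - branch_point m a"
      by (rule order_trans[OF _ diff]) simp
    then have "branch_point m b - branch_point m a \<le> measure lborel I"
      using that by (intro is_interval_diff_le_measure I) (auto simp: A_def)
    then show False
      using diff short by linarith
  qed
  have vertex: "\<exists>y. length y = n \<and> (\<forall>a\<in>A. prefix_value m a n = p \<longrightarrow> branch_vertex a n = y)" for p
  proof (cases "\<exists>b\<in>A. prefix_value m b n = p")
    case True
    then obtain b where b: "b \<in> A" "prefix_value m b n = p" by blast
    have "branch_vertex a n = branch_vertex b n" if "a \<in> A" "prefix_value m a n = p" for a
      using that b by (intro prefix_value_inj) (auto simp: A_def)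
    moreover have "length (branch_vertex b n) = n"
      by (simp add: branch_vertex_def)
    ultimately show ?thesis by blast
  next
    case False
    then show ?thesis
      \<comment> \<open>No branch in \<open>A\<close> has this prefix integer, so any list of length
        \<open>n\<close> serves.\<close>
      by (intro exI[of _ "replicate n 0"]) auto
  qed
  have "\<exists>p. \<forall>a\<in>A. prefix_value m a n = p \<or> prefix_value m a n = Suc p"
  proof (cases "A = {}")
    case False
    \<comment> \<open>With the least prefix integer as \<open>p\<close>, the one-sided bound
      \<open>close\<close> leaves only \<open>p\<close> and \<open>Suc p\<close>.\<close>
    define p where "p = (LEAST p. p \<in> (\<lambda>a. prefix_value m a n) ` A)"
    have "p \<in> (\<lambda>a. prefix_value m a n) ` A"
      unfolding p_def by (rule LeastI_ex) (use False in auto)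
    then obtain b where b: "b \<in> A" "prefix_value m b n = p" by blast
    have "prefix_value m a n = p \<or> prefix_value m a n = Suc p" if "a \<in> A" for a
    proof -
      have "p \<le> prefix_value m a n"
        unfolding p_def using that by (intro Least_le) auto
      then show ?thesis
        using close[OF b(1) that] b(2) by linarith
    qed
    then show ?thesis by blast
  qed simp
  then obtain p where p: "\<forall>a\<in>A. prefix_value m a n = p \<or> prefix_value m a n = Suc p" ..
  obtain y z where "length y = n" "\<forall>a\<in>A. prefix_value m a n = p \<longrightarrow> branch_vertex a n = y"
    and "length z = n" "\<forall>a\<in>A. prefix_value m a n = Suc p \<longrightarrow> branch_vertex a n = z"
    using vertex by meson
  with p show thesis
    by (intro that[of y z]) (auto simp: A_def)
qed

section \<open>Upper bounds for the infimum from explicit competitors\<close>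

text \<open>The liminf ignores the levels below \<open>n\<close> and \<open>u\<close> converges
  along branches, so domination at the vertices from level \<open>n\<close> on puts \<open>w\<close>
  in the class.\<close>

lemma upper_class_INF_le:
  assumes "superharmonic m F w"
    and lim: "\<And>a. a \<in> branches m \<Longrightarrow> (\<lambda>k. u (branch_vertex a k)) \<longlonglongrightarrow> f (branch_point m a)"
    and le: "\<And>a k. a \<in> branches m \<Longrightarrow> k \<ge> n \<Longrightarrow>
           u (branch_vertex a k) + c * indicator I (branch_point m a) \<le> w (branch_vertex a k)"
  shows "(INF w \<in> upper_class m F f I c. ereal (w [] - u [])) \<le> ereal (w [] - u [])"
proof (rule INF_lower)
  have "ereal (f (branch_point m a) + c * indicator I (branch_point m a))
      \<le> liminf (\<lambda>k. ereal (w (branch_vertex a k)))" if a: "a \<in> branches m" for a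
  proof -
    let ?e = "c * indicator I (branch_point m a)"
    have "(\<lambda>k. ereal (u (branch_vertex a k) + ?e)) \<longlonglongrightarrow> ereal (f (branch_point m a) + ?e)"
      using lim[OF a] by (intro tendsto_intros)
    then have "ereal (f (branch_point m a) + ?e) = liminf (\<lambda>k. ereal (u (branch_vertex a k) + ?e))"
      by (intro lim_imp_Liminf[symmetric]) auto
    also have "\<dots> \<le> liminf (\<lambda>k. ereal (w (branch_vertex a k)))"
      using le[OF a] by (intro Liminf_mono) (auto simp: eventually_sequentially)
    finally show ?thesis .
  qed
  then show "w \<in> upper_class m F f I c"
    using assms(1) by (simp add: upper_class_def)
qed

lemma short_interval_INF_le:
  assumes m: "m \<ge> 2" and F: "averaging_operator m F"
    and incr: "\<And>x t j. x \<in> topspace (Euclidean_space m) \<Longrightarrow> j < m \<Longrightarrow> t \<ge> 0 \<Longrightarrow>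
           F (x(j := x j + t)) \<le> F x + t * \<kappa>"
    and \<kappa>: "\<kappa> > 0" and c: "c \<ge> 0" and u: "solves_DP m F f u"
    and I: "is_interval I" "bounded I" "measure lborel I < 1 / real m ^ n"
  shows "(INF w \<in> upper_class m F f I c. ereal (w [] - u [])) \<le> ereal (2 * c * \<kappa> ^ n)"
proof -
  obtain y z where len: "length y = n" "length z = n"
    and cover: "\<And>a. a \<in> branches m \<Longrightarrow> branch_point m a \<in> I \<Longrightarrow> branch_vertex a n \<in> {y, z}"
    using short_interval_two_vertices[OF m I] by blast
  \<comment> \<open>One barrier for each of the two vertices, whence the factor 2. From level
    \<open>n\<close> on, the one over the right vertex equals 1 along any branch ending in
    \<open>I\<close>.\<close>
  let ?w = "\<lambda>x. u x + c * barrier \<kappa> y x + c * barrier \<kappa> z x"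
  have "superharmonic m F ?w"
    using u by (intro superharmonic_add_barrier F incr \<kappa> c)
      (auto simp: solves_DP_def harmonic_def)
  moreover have "u (branch_vertex a k) + c * indicator I (branch_point m a) \<le> ?w (branch_vertex a k)"
    if a: "a \<in> branches m" and k: "k \<ge> n" for a k
  proof -
    have "take n (branch_vertex a k) = branch_vertex a n"
      using k by (simp add: branch_vertex_def take_map)
    moreover have "length (branch_vertex a k) = k"
      by (simp add: branch_vertex_def)
    ultimately have "indicator I (branch_point m a)
        \<le> barrier \<kappa> y (branch_vertex a k) + barrier \<kappa> z (branch_vertex a k)"
      using cover[OF a] k len by (auto simp: barrier_def indicator_def)
    then have "c * indicator I (branch_point m a)
        \<le> c * (barrier \<kappa> y (branch_vertex a k) + barrier \<kappa> z (branch_vertex a k))"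
      using c by (rule mult_left_mono)
    then show ?thesis
      by (simp add: distrib_left)
  qed
  ultimately have "(INF w \<in> upper_class m F f I c. ereal (w [] - u [])) \<le> ereal (?w [] - u [])"
    using u by (intro upper_class_INF_le[where n = n]) (auto simp: solves_DP_def)
  then show ?thesis
    by (simp add: barrier_Nil len algebra_simps)
qed

section \<open>The two-sided estimate\<close>

text \<open>The last hypothesis excludes \<gamma> < 0 with m|I| > 1. There the right-hand side tends
  to 0 as \<gamma> decreases, while for \<open>I = {0..1}\<close> the infimum equals
  \<open>c\<close>.\<close>

theorem theorem1p1:
  fixes m :: nat and F :: "(nat \<Rightarrow> real) \<Rightarrow> real" and \<kappa> c \<gamma> :: real
    and f :: "real \<Rightarrow> real" and I :: "real set" and u :: "nat list \<Rightarrow> real"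
  assumes "m \<ge> 3"
    and "averaging_operator m F" and "permutation_invariant m F"
    and "0 < \<kappa>" and "\<kappa> < 1"
    and "\<And>x c'. x \<in> topspace (Euclidean_space m) \<Longrightarrow> c' > 0 \<Longrightarrow>
           F (x(0 := x 0 + c')) \<le> F x + c' * \<kappa>"
    and "continuous_on {0..1} f"
    and "is_interval I" and "I \<subseteq> {0..1}"
    and "c > 0"
    and "solves_DP m F f u"
    and "\<gamma> \<le> - log (real m) \<kappa>"
    and "\<gamma> \<ge> 0 \<or> real m * measure lborel I \<le> 1"
  shows "0 \<le> (INF w \<in> upper_class m F f I c. ereal (w [] - u []))
       \<and> (INF w \<in> upper_class m F f I c. ereal (w [] - u []))
           \<le> ereal (2 * c * (real m * measure lborel I) powr \<gamma>)"
proof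
  let ?inf = "INF w \<in> upper_class m F f I c. ereal (w [] - u [])"
  let ?s = "measure lborel I"
  have harm: "subharmonic m F u" "superharmonic m F u"
    and lim: "\<And>a. a \<in> branches m \<Longrightarrow> (\<lambda>k. u (branch_vertex a k)) \<longlonglongrightarrow> f (branch_point m a)"
    using assms(11) by (auto simp: solves_DP_def harmonic_def)
  show "0 \<le> ?inf"
  proof (rule INF_greatest)
    fix w assume w: "w \<in> upper_class m F f I c"
    have "u [] \<le> w []"
    proof (rule comparison_principle[OF assms(2) _ harm(1)])
      show "m > 0" "superharmonic m F w"
        using w \<open>m \<ge> 3\<close> by (auto simp: upper_class_def)
    next
      fix a assume a: "a \<in> branches m"
      have "ereal (f (branch_point m a)) \<le> ereal (f (branch_point m a) + c * indicator I (branch_point m a))"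
        using \<open>c > 0\<close> by simp
      also have "\<dots> \<le> liminf (\<lambda>k. ereal (w (branch_vertex a k)))"
        using w a by (simp add: upper_class_def)
      finally show "\<exists>l. (\<lambda>k. u (branch_vertex a k)) \<longlonglongrightarrow> l \<and>
           ereal l \<le> liminf (\<lambda>k. ereal (w (branch_vertex a k)))"
        using lim[OF a] by blast
    qed
    then show "0 \<le> ereal (w [] - u [])" by simp
  qed
  have "bounded I"
    using assms(9) bounded_closed_interval bounded_subset by blast
  have short: "?inf \<le> ereal (2 * c * \<kappa> ^ n)" if "?s < 1 / real m ^ n" for n
    using that assms \<open>bounded I\<close>
    by (intro short_interval_INF_le permutation_invariant_increment[OF assms(3,6)]) auto
  have m: "real m > 1"
    using \<open>m \<ge> 3\<close> by simp
  consider "?s = 0" | "0 < ?s" "real m * ?s \<le> 1" | "real m * ?s > 1"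
    using measure_nonneg[of lborel I] by linarith
  then show "?inf \<le> ereal (2 * c * (real m * ?s) powr \<gamma>)"
  proof cases
    case 1
    \<comment> \<open>\<open>0 powr \<gamma>\<close> is 0 for every \<gamma>, so the infimum must be
      shown to be at most 0. A null interval is short at every level, and \<open>n\<close> can tend
      to infinity.\<close>
    have "(\<lambda>n. 2 * c * \<kappa> ^ n) \<longlonglongrightarrow> 2 * c * 0"
      using assms(4,5) by (intro tendsto_intros LIMSEQ_realpow_zero) auto
    then have "(\<lambda>n. ereal (2 * c * \<kappa> ^ n)) \<longlonglongrightarrow> 0"
      by (simp add: zero_ereal_def)
    then have "?inf \<le> 0"
      by (rule LIMSEQ_le_const) (use short 1 m in auto)
    with 1 show ?thesis
      by (simp add: zero_ereal_def)
  next
    case 2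
    \<comment> \<open>Minimality gives \<open>1 / m ^ Suc n \<le> ?s < 1 / m ^ n\<close> with
      \<open>k = Suc n\<close>. The right half permits barriers at level \<open>n\<close>; the left
      half gives \<open>1 / m ^ n \<le> m * ?s\<close>, the origin of the factor \<open>m\<close> in
      the bound.\<close>
    define k where "k = (LEAST k. 1 / real m ^ k \<le> ?s)"
    have "\<exists>k. 1 / real m ^ k \<le> ?s"
      using real_arch_pow_inv[OF \<open>0 < ?s\<close>, of "1 / real m"] m
      by (auto simp: power_one_over intro: less_imp_le)
    then have k: "1 / real m ^ k \<le> ?s"
      unfolding k_def by (rule LeastI_ex)
    have "1 * ?s < real m * ?s"
      using 2 m by (intro mult_strict_right_mono)
    then have "?s < 1"
      using 2 by linarith
    with k have "k \<noteq> 0"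
      by (auto intro: ccontr)
    then obtain n where n: "k = Suc n"
      using not0_implies_Suc by blast
    then have "\<not> 1 / real m ^ n \<le> ?s"
      using not_less_Least[of n "\<lambda>k. 1 / real m ^ k \<le> ?s"] unfolding k_def by simp
    then have "?inf \<le> ereal (2 * c * \<kappa> ^ n)"
      by (intro short) simp
    also have "\<kappa> ^ n \<le> (real m * ?s) powr \<gamma>"
    proof -
      have "\<kappa> ^ n = (real m powr log (real m) \<kappa>) powr real n"
        using assms(4) m by (simp add: powr_realpow)
      also have "\<dots> = (1 / real m ^ n) powr (- log (real m) \<kappa>)"
        using m by (simp add: powr_powr powr_realpow[symmetric] powr_minus_divide[symmetric] mult.commute)
      also have "\<dots> \<le> (real m * ?s) powr (- log (real m) \<kappa>)"
      proof (rule powr_mono2)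
        show "0 \<le> - log (real m) \<kappa>"
          using assms(4,5) m by simp
        show "1 / real m ^ n \<le> real m * ?s"
          using k n m by (simp add: field_simps)
      qed simp
      \<comment> \<open>The base is at most 1, so passing to the smaller exponent \<gamma> increases
        the power.\<close>
      also have "\<dots> \<le> (real m * ?s) powr \<gamma>"
        using 2 m assms(12) by (intro powr_mono') auto
      finally show ?thesis .
    qed
    then have "ereal (2 * c * \<kappa> ^ n) \<le> ereal (2 * c * (real m * ?s) powr \<gamma>)"
      using \<open>c > 0\<close> by simp
    finally show ?thesis .
  next
    case 3
    \<comment> \<open>For a long interval the translate \<open>u + c\<close> suffices: it costs
      \<open>c\<close>, and the power is at least 1 since the last hypothesis now forces \<gamma>
      \<ge> 0.\<close>
    have "superharmonic m F (\<lambda>x. u x + c)"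
      using harm(2) averaging_operator_add_const[OF assms(2)]
      by (simp add: superharmonic_def successor_values_def)
    then have "?inf \<le> ereal ((u [] + c) - u [])"
      by (rule upper_class_INF_le[OF _ lim]) (use \<open>c > 0\<close> in \<open>auto simp: indicator_def\<close>)
    also have "\<dots> \<le> ereal (2 * c * (real m * ?s) powr \<gamma>)"
    proof -
      have "1 \<le> (real m * ?s) powr \<gamma>"
        using 3 assms(13) by (intro ge_one_powr_ge_zero) auto
      then have "c * 1 \<le> c * (2 * (real m * ?s) powr \<gamma>)"
        using \<open>c > 0\<close> by (intro mult_left_mono) auto
      then show ?thesis by simp
    qed
    finally show ?thesis .
  qed
qed

end
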